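(* Let $F(x)=f(x)+\delta_C(x)+\Phi(|x|)$ be as in the context, and let $\{\beta_k\}_{k\ge 0}\subset[0,1)$ satisfy $\sup_{k\ge 0}\beta_k<1$. Suppose that $\phi'_+$ is Lipschitz continuous on $[0,\infty)$, and suppose in addition that the function $H_1:\mathbb{R}^n\times\mathbb{R}^n\to(-\infty,\infty]$, $H_1(x,y):=f(x)+\delta_C(x)+\Phi(|x|)+\frac{L}{2}\|x-y\|^2$, is a KL function. Let $\{x^k\}$ be the sequence generated by the algorithm IRL$_1e_1$ described in the context. Then $\sum_{k=1}^\infty\|x^k-x^{k-1}\|<\infty$ and $\{x^k\}$ converges to a stationary point of the problem $\min_{x\in\mathbb{R}^n}F(x)$, i.e., to a point $\bar x$ with $0\in\partial F(\bar x)$.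
   Context: Setting. $\mathbb{R}^n$ carries the Euclidean inner product $\langle\cdot,\cdot\rangle$ and norm $\|\cdot\|$. The function $f:\mathbb{R}^n\to\mathbb{R}$ is convex and continuously differentiable, and its gradient is Lipschitz continuous with modulus $L>0$. $C\subseteq\mathbb{R}^n$ is a nonempty closed convex set and $\delta_C$ is its indicator function ($0$ on $C$, $+\infty$ off $C$). $\Phi(y)=\sum_{i=1}^n\phi(y_i)$ for $y\in\mathbb{R}^n_+$, where $\phi:\mathbb{R}_+\to\mathbb{R}_+$ is a continuous concave function with $\phi(0)=0$ that is continuously differentiable on $(0,\infty)$ and such that the limit $\ell:=\lim_{t\downarrow 0}\phi'(t)$ exists (as a finite real number). For $x\in\mathbb{R}^n$, $|x|$ is the vector with entries $|x_i|$. It is assumed that $F(x):=f(x)+\delta_C(x)+\Phi(|x|)$ is level-bounded (all sets $\{x: F(x)\le\alpha\}$, $\alpha\in\mathbb{R}$, are bounded). Notation. $\phi'_+(t):=\lim_{h\downarrow 0}\frac{\phi(t+h)-\phi(t)}{h}$ is the right-hand derivative, and $\Phi'_+(|y|):=(\phi'_+(|y_1|),\dots,\phi'_+(|y_n|))$. For a proper function $g$ and $x$ with $g(x)<\infty$, the regular subdifferential is $\hat\partial g(x)=\{\zeta:\liminf_{z\to x,z\ne x}\frac{g(z)-g(x)-\langle\zeta,z-x\rangle}{\|z-x\|}\ge 0\}$, and $\partial g(x)$ is the limiting subdifferential: the set of $\zeta$ for which there exist $x^k\to x$ with $g(x^k)\to g(x)$ and $\zeta^k\in\hat\partial g(x^k)$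 with $\zeta^k\to\zeta$; $\partial g(x)=\emptyset$ if $g(x)=\infty$. $\mathrm{dom}\,\partial g:=\{x:\partial g(x)\ne\emptyset\}$. Distances to sets are Euclidean, with $\mathrm{dist}(x,\emptyset)=\infty$. KL functions. For $a\in(0,\infty]$, $\Xi_a$ is the set of all concave continuous functions $\varphi:[0,a)\to\mathbb{R}_+$ that are continuously differentiable on $(0,a)$ with positive derivatives and satisfy $\varphi(0)=0$. A proper closed (i.e., lower semicontinuous) function $h$ satisfies the KL property at $\hat x\in\mathrm{dom}\,\partial h$ if there exist $a\in(0,\infty]$, a neighborhood $V$ of $\hat x$ and $\varphi\in\Xi_a$ such that $\varphi'(h(x)-h(\hat x))\,\mathrm{dist}(0,\partial h(x))\ge 1$ for every $x\in V$ with $h(\hat x)<h(x)<h(\hat x)+a$. $h$ is a KL function if it satisfies the KL property at every point of $\mathrm{dom}\,\partial h$. Algorithm IRL$_1e_1$. Start with $x^0=x^{-1}\in C$ and $\{\beta_k\}\subset[0,1)$. For $k=0,1,2,\dots$ (run without termination) set $s^{k+1}=\Phi'_+(|x^k|)$, $y^k=x^k+\beta_k(x^k-x^{k-1})$, and let $x^{k+1}$ be the unique minimizer over $y\in C$ of $\langle\nabla f(y^k),y-y^k\rangle+\frac{L}{2}\|y-y^k\|^2+\sum_{i=1}^n s^{k+1}_i|y_i|$. *)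

theory Defs
  imports "HOL-Analysis.Analysis"
begin

text \<open>Variational analysis of extended-real-valued functions on Euclidean spaces.  A product of
  Euclidean spaces carries the Euclidean norm in the library, so everything below also applies
  to functions on pairs.\<close>

definition proper_fun :: "('a \<Rightarrow> ereal) \<Rightarrow> bool" where
  "proper_fun g \<longleftrightarrow> (\<forall>x. g x \<noteq> -\<infinity>) \<and> (\<exists>x. g x \<noteq> \<infinity>)"

definition lsc_fun :: "('a::topological_space \<Rightarrow> ereal) \<Rightarrow> bool" where
  "lsc_fun g \<longleftrightarrow> (\<forall>x. g x \<le> Liminf (at x) g)"

definition level_bounded :: "('a::metric_space \<Rightarrow> ereal) \<Rightarrow> bool" where
  "level_bounded g \<longleftrightarrow> (\<forall>\<alpha>::real. bounded {x. g x \<le> ereal \<alpha>})"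

definition indicator_fun :: "'a set \<Rightarrow> 'a \<Rightarrow> ereal" where
  "indicator_fun C x = (if x \<in> C then 0 else \<infinity>)"

definition regular_subdiff :: "('a::euclidean_space \<Rightarrow> ereal) \<Rightarrow> 'a \<Rightarrow> 'a set" where
  "regular_subdiff g x = {\<zeta>. \<bar>g x\<bar> \<noteq> \<infinity> \<and>
     0 \<le> Liminf (at x) (\<lambda>z. (g z - g x - ereal (\<zeta> \<bullet> (z - x))) / ereal (norm (z - x)))}"

definition limiting_subdiff :: "('a::euclidean_space \<Rightarrow> ereal) \<Rightarrow> 'a \<Rightarrow> 'a set" where
  "limiting_subdiff g x = {\<zeta>. \<bar>g x\<bar> \<noteq> \<infinity> \<and>
     (\<exists>X Z. X \<longlonglongrightarrow> x \<and> (\<lambda>k. g (X k)) \<longlonglongrightarrow> g x \<and>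
        (\<forall>k. Z k \<in> regular_subdiff g (X k)) \<and> Z \<longlonglongrightarrow> \<zeta>)}"

definition dom_subdiff :: "('a::euclidean_space \<Rightarrow> ereal) \<Rightarrow> 'a set" where
  "dom_subdiff g = {x. limiting_subdiff g x \<noteq> {}}"

text \<open>Unlike \<^const>\<open>infdist\<close> and \<^const>\<open>setdist\<close>, the distance to the empty set is \<open>\<infinity>\<close>.\<close>

definition edist_set :: "'a::metric_space \<Rightarrow> 'a set \<Rightarrow> ereal" where
  "edist_set x S = (INF y\<in>S. ereal (dist x y))"

text \<open>The elements of \<open>desingularizers a\<close> have domain \<open>[0, a)\<close> with \<open>a \<in> (0, \<infinity>]\<close>; as total
  functions their values elsewhere are irrelevant.\<close>

definition desingularizers :: "ereal \<Rightarrow> (real \<Rightarrow> real) set" where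
  "desingularizers a = {\<phi>.
     concave_on {t. 0 \<le> t \<and> ereal t < a} \<phi> \<and>
     continuous_on {t. 0 \<le> t \<and> ereal t < a} \<phi> \<and>
     (\<forall>t. 0 \<le> t \<and> ereal t < a \<longrightarrow> 0 \<le> \<phi> t) \<and>
     \<phi> C1_differentiable_on {t. 0 < t \<and> ereal t < a} \<and>
     (\<forall>t. 0 < t \<and> ereal t < a \<longrightarrow> 0 < deriv \<phi> t) \<and>
     \<phi> 0 = 0}"

definition KL_property_at :: "('a::euclidean_space \<Rightarrow> ereal) \<Rightarrow> 'a \<Rightarrow> bool" where
  "KL_property_at h p \<longleftrightarrow>
     (\<exists>a>0. \<exists>V. open V \<and> p \<in> V \<and> (\<exists>\<phi>\<in>desingularizers a.
        \<forall>x\<in>V. h p < h x \<and> h x < h p + a \<longrightarrow>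
          1 \<le> ereal (deriv \<phi> (real_of_ereal (h x - h p))) * edist_set 0 (limiting_subdiff h x)))"

definition KL_function :: "('a::euclidean_space \<Rightarrow> ereal) \<Rightarrow> bool" where
  "KL_function h \<longleftrightarrow> proper_fun h \<and> lsc_fun h \<and> (\<forall>p\<in>dom_subdiff h. KL_property_at h p)"

definition right_deriv :: "(real \<Rightarrow> real) \<Rightarrow> real \<Rightarrow> real" where
  "right_deriv \<phi> t = Lim (at_right 0) (\<lambda>h. (\<phi> (t + h) - \<phi> t) / h)"

definition vec_abs :: "real ^ 'n \<Rightarrow> real ^ 'n" where
  "vec_abs x = (\<chi> i. \<bar>x $ i\<bar>)"

definition separable_sum :: "(real \<Rightarrow> real) \<Rightarrow> real ^ 'n \<Rightarrow> real" where
  "separable_sum \<phi> y = (\<Sum>i\<in>UNIV. \<phi> (y $ i))"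

definition separable_right_deriv :: "(real \<Rightarrow> real) \<Rightarrow> real ^ 'n \<Rightarrow> real ^ 'n" where
  "separable_right_deriv \<phi> y = (\<chi> i. right_deriv \<phi> (y $ i))"

definition objective ::
  "(real ^ 'n \<Rightarrow> real) \<Rightarrow> (real ^ 'n) set \<Rightarrow> (real \<Rightarrow> real) \<Rightarrow> real ^ 'n \<Rightarrow> ereal" where
  "objective f C \<phi> x = ereal (f x) + indicator_fun C x + ereal (separable_sum \<phi> (vec_abs x))"

definition H1 ::
  "real \<Rightarrow> (real ^ 'n \<Rightarrow> real) \<Rightarrow> (real ^ 'n) set \<Rightarrow> (real \<Rightarrow> real)
    \<Rightarrow> (real ^ 'n) \<times> (real ^ 'n) \<Rightarrow> ereal" where
  "H1 L f C \<phi> = (\<lambda>(x, y). ereal (f x) + indicator_fun C x + ereal (separable_sum \<phi> (vec_abs x))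
                   + ereal (L / 2 * (norm (x - y))\<^sup>2))"

text \<open>\<open>\<nabla>f\<close> is passed as \<open>gf\<close>.  The convention \<open>x\<^sup>-\<^sup>1 = x\<^sup>0\<close> is encoded by truncated subtraction:
  \<open>x (k - 1) = x 0\<close> for \<open>k = 0\<close>.  A nonnegative concave \<open>\<phi>\<close> on \<open>[0, \<infinity>)\<close> is
  nondecreasing, so the weights \<open>s\<close> are nonnegative and the subproblem is strongly convex; its
  minimizer over \<open>C\<close> is therefore unique without demanding this separately.\<close>

definition extrapolated :: "(nat \<Rightarrow> real) \<Rightarrow> (nat \<Rightarrow> real ^ 'n) \<Rightarrow> nat \<Rightarrow> real ^ 'n" where
  "extrapolated \<beta> x k = x k + \<beta> k *\<^sub>R (x k - x (k - 1))"

definition IRL1e1_sequence ::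
  "real \<Rightarrow> (real ^ 'n \<Rightarrow> real ^ 'n) \<Rightarrow> (real ^ 'n) set \<Rightarrow> (real \<Rightarrow> real) \<Rightarrow> (nat \<Rightarrow> real)
    \<Rightarrow> (nat \<Rightarrow> real ^ 'n) \<Rightarrow> bool" where
  "IRL1e1_sequence L gf C \<phi> \<beta> x \<longleftrightarrow> x 0 \<in> C \<and>
     (\<forall>k. let s = separable_right_deriv \<phi> (vec_abs (x k)); y = extrapolated \<beta> x k in
        is_arg_min
          (\<lambda>z. gf y \<bullet> (z - y) + L / 2 * (norm (z - y))\<^sup>2 + (\<Sum>i\<in>UNIV. s $ i * \<bar>z $ i\<bar>))
          (\<lambda>z. z \<in> C) (x (Suc k)))"

end

theory Submission
  imports Defs
begin

text \<open>The pairs of consecutive iterates are an inexact descent sequence for \<open>H1\<close>, and the KL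
  inequality turns such a sequence into one of finite length.

  Descent. Each iteration minimizes over \<open>C\<close> a strongly convex majorant of the objective up to a
  constant: the Lipschitz gradient bounds \<open>f\<close> from above by its quadratic model at the extrapolated
  point \<open>y\<close>, and concavity bounds \<open>\<phi>\<close> from above by its tangents at the old entries. Comparing the
  minimizer with the old iterate, where convexity of \<open>f\<close> makes the linear part of the model
  an underestimate, gives with \<open>b = (SUP k. \<beta> k)\<close>
  \<open>H1 (x (k+2), x (k+1)) \<le> H1 (x (k+1), x k) - L/2 * (1 - b\<^sup>2) * \<parallel>x (k+1) - x k\<parallel>\<^sup>2\<close>
  (lemma \<open>IRL_step_descent\<close>). The values of \<open>H1\<close> therefore decrease, level-boundedness confines
  the iterates, and the steps tend to 0.

  Subgradients. The subproblem is solved with weights and a gradient that belong to earlier points;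
  correcting them costs an error proportional to the last two steps. Instead of invoking a
  sum rule, the optimality condition is read as: a convex function on \<open>C\<close>, built from the
  correct gradient and weights, lies above a cone of small slope at the new iterate. Separating
  its epigraph from that cone yields a subgradient that is as short as the slope
  (lemma \<open>subgradient_of_conic_minorant\<close>). Since \<open>\<phi>\<close> has a Lipschitz right derivative, it differs from its
  linearization only by a quadratic term, so this vector is a proximal, hence regular, subgradient
  of the objective (lemma \<open>IRL_step_proximal_subgradient\<close>); adding the gradient of the
  coupling term \<open>L/2 * \<parallel>x - y\<parallel>\<^sup>2\<close> gives one of \<open>H1\<close>.

  Finite length. At a cluster point \<open>p\<close> of the iterates, \<open>(p, p)\<close> has 0 as a limiting subgradient
  of \<open>H1\<close>, so the KL inequality is available near it. Combined with descent and the subgradient bound it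
  makes each step at most a third of the preceding one plus a telescoping term
  (lemma \<open>KL_step_bound\<close>). Started close enough to \<open>p\<close>, the sequence can then no longer
  leave the neighbourhood, and its length is finite (lemma \<open>KL_finite_length\<close>). It converges to
  \<open>p\<close>, and the vanishing subgradients of the objective show that \<open>p\<close> is stationary.\<close>

section \<open>Subgradients by separation and by quadratic minorants\<close>

text \<open>The epigraph of \<open>g\<close> is convex and disjoint from the open region below the concave cone
  \<open>z \<mapsto> g p - e * \<parallel>z - p\<parallel>\<close>, so a hyperplane separates them. The cone is finite on the whole
  space, so the hyperplane is not vertical; it is then the graph of an affine function between the
  two, and lying above the cone bounds its slope by \<open>e\<close>. This replaces the sum rule for
  \<open>g + e * \<parallel>z - p\<parallel>\<close> at its minimizer \<open>p\<close>.\<close>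

lemma subgradient_of_conic_minorant:
  fixes g :: "'a::euclidean_space \<Rightarrow> real"
  assumes g: "convex_on C g" and p: "p \<in> C" and e: "0 \<le> e"
    and minor: "\<And>z. z \<in> C \<Longrightarrow> g p - e * norm (z - p) \<le> g z"
  obtains \<zeta> where "norm \<zeta> \<le> e" "\<And>z. z \<in> C \<Longrightarrow> g p + \<zeta> \<bullet> (z - p) \<le> g z"
proof -
  define T where "T = {w :: 'a \<times> real. snd w < g p - e * norm (fst w - p)}"
  have "convex T"
  proof (rule convexI)
    fix v w :: "'a \<times> real" and s t :: real
    assume vw: "v \<in> T" "w \<in> T" and st: "0 \<le> s" "0 \<le> t" "s + t = 1"
    have "s *\<^sub>R fst v + t *\<^sub>R fst w - p = s *\<^sub>R (fst v - p) + t *\<^sub>R (fst w - p)"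
      using st(3) by (simp add: algebra_simps flip: scaleR_left.add)
    then have "norm (s *\<^sub>R fst v + t *\<^sub>R fst w - p) \<le> s * norm (fst v - p) + t * norm (fst w - p)"
      using norm_triangle_ineq[of "s *\<^sub>R (fst v - p)" "t *\<^sub>R (fst w - p)"] st by simp
    then have "e * norm (s *\<^sub>R fst v + t *\<^sub>R fst w - p)
        \<le> e * (s * norm (fst v - p) + t * norm (fst w - p))"
      using e by (rule mult_left_mono)
    moreover have "s * (snd v + e * norm (fst v - p)) + t * (snd w + e * norm (fst w - p)) < g p"
      using vw st convex_bound_lt[of _ "g p" _ s t] by (simp add: T_def)
    ultimately show "s *\<^sub>R v + t *\<^sub>R w \<in> T"
      by (simp add: T_def algebra_simps)
  qed
  moreover have "convex (epigraph C g)"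
    using g by (simp add: convex_epigraph)
  moreover have "(p, g p) \<in> epigraph C g"
    using p by (simp add: mem_epigraph)
  moreover have "(p, g p - 1) \<in> T"
    by (simp add: T_def)
  moreover have "epigraph C g \<inter> T = {}"
    using minor by (force simp: T_def epigraph_def)
  ultimately obtain a b where a: "a \<noteq> 0"
    and S: "\<And>w. w \<in> epigraph C g \<Longrightarrow> a \<bullet> w \<le> b" and T: "\<And>w. w \<in> T \<Longrightarrow> b \<le> a \<bullet> w"
    using separating_hyperplane_sets[of "epigraph C g" T] by blast
  obtain u \<tau> where uv: "a = (u, \<tau>)" by (cases a)
  have S': "u \<bullet> z + \<tau> * r \<le> b" if "z \<in> C" "g z \<le> r" for z r
    using S[of "(z, r)"] that by (simp add: uv mem_epigraph)
  have T': "b \<le> u \<bullet> z + \<tau> * r" if "r < g p - e * norm (z - p)" for z r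
    using T[of "(z, r)"] that by (simp add: uv T_def)
  have "b \<le> u \<bullet> p + \<tau> * (g p - 1)" "u \<bullet> p + \<tau> * g p \<le> b"
    using T'[of "g p - 1" p] S'[of p "g p"] p by auto
  then have "\<tau> \<le> 0" by (simp add: algebra_simps)
  have "\<tau> \<noteq> 0"
  proof
    assume 0: "\<tau> = 0"
    have "b \<le> u \<bullet> (p - u)"
      using T'[of "g p - e * norm u - 1" "p - u"] by (simp add: 0)
    moreover have "u \<bullet> p \<le> b" using S'[of p "g p"] p by (simp add: 0)
    ultimately have "u \<bullet> u \<le> 0" by (simp add: inner_diff_right)
    then have "u = 0" using inner_gt_zero_iff[of u] by linarith
    with a uv 0 show False by (simp add: zero_prod_def)
  qed
  with \<open>\<tau> \<le> 0\<close> have \<tau>: "\<tau> < 0" by simp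
  \<comment> \<open>The strict inequality defining the cone is lost in the limit.\<close>
  have T'': "b \<le> u \<bullet> z + \<tau> * (g p - e * norm (z - p))" for z
  proof (rule field_le_epsilon)
    fix d :: real assume "0 < d"
    then show "b \<le> u \<bullet> z + \<tau> * (g p - e * norm (z - p)) + d"
      using T'[of "g p - e * norm (z - p) + d / \<tau>" z] \<tau>
      by (simp add: algebra_simps divide_neg_pos divide_pos_neg)
  qed
  have b: "b = u \<bullet> p + \<tau> * g p"
    using T''[of p] S'[of p "g p"] p by simp
  define \<zeta> where "\<zeta> = (- inverse \<tau>) *\<^sub>R u"
  have u: "u = (- \<tau>) *\<^sub>R \<zeta>" using \<tau> by (simp add: \<zeta>_def)
  show thesis
  proof
    have "norm u * norm u \<le> - \<tau> * e * norm u"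
      using T''[of "p - u"] by (simp add: b algebra_simps inner_diff_right flip: power2_norm_eq_inner power2_eq_square)
    moreover have "0 \<le> - \<tau> * e" using \<tau> e by (simp add: mult_nonpos_nonneg)
    ultimately have "norm u \<le> - \<tau> * e"
      by (cases "u = 0") (use mult_le_cancel_right[of "norm u" "norm u" "- \<tau> * e"] in auto)
    then show "norm \<zeta> \<le> e" using \<tau> by (simp add: u)
  next
    fix z assume "z \<in> C"
    then have "u \<bullet> z + \<tau> * g z \<le> u \<bullet> p + \<tau> * g p" using S'[of z "g z"] b by simp
    then have "- \<tau> * (\<zeta> \<bullet> (z - p)) \<le> - \<tau> * (g z - g p)"
      by (simp add: u algebra_simps inner_diff_right)
    then have "\<zeta> \<bullet> (z - p) \<le> g z - g p"
      using \<tau> by (simp add: mult_le_cancel_left)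
    then show "g p + \<zeta> \<bullet> (z - p) \<le> g z" by simp
  qed
qed

text \<open>A quadratic error is negligible against \<open>\<parallel>z - p\<parallel>\<close>.\<close>

lemma proximal_subgradient_regular:
  fixes g :: "'a::euclidean_space \<Rightarrow> ereal"
  assumes fin: "g p = ereal r"
    and prox: "\<And>z. ereal (r + \<zeta> \<bullet> (z - p) - K * (norm (z - p))\<^sup>2) \<le> g z"
  shows "\<zeta> \<in> regular_subdiff g p"
proof -
  have "((\<lambda>z. - K * norm (z - p)) \<longlongrightarrow> - K * norm (p - p)) (at p)"
    by (intro tendsto_intros)
  then have "((\<lambda>z. ereal (- K * norm (z - p))) \<longlongrightarrow> 0) (at p)"
    by (simp add: zero_ereal_def)
  then have "Liminf (at p) (\<lambda>z. ereal (- K * norm (z - p))) = 0"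
    by (rule lim_imp_Liminf[OF trivial_limit_at])
  moreover have "Liminf (at p) (\<lambda>z. ereal (- K * norm (z - p)))
     \<le> Liminf (at p) (\<lambda>z. (g z - g p - ereal (\<zeta> \<bullet> (z - p))) / ereal (norm (z - p)))"
  proof (rule Liminf_mono)
    have "ereal (- K * norm (z - p)) \<le> (g z - g p - ereal (\<zeta> \<bullet> (z - p))) / ereal (norm (z - p))"
      if "z \<noteq> p" for z
    proof (cases "g z")
      case (real s)
      have "- K * norm (z - p) * norm (z - p) \<le> s - r - \<zeta> \<bullet> (z - p)"
        using prox[of z] by (simp add: real power2_eq_square algebra_simps)
      then show ?thesis
        using that by (simp add: fin real pos_le_divide_eq)
    next
      case PInf
      then show ?thesis using that by (simp add: fin)
    next
      case MInf
      then show ?thesis using prox[of z] by simp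
    qed
    then show "\<forall>\<^sub>F z in at p. ereal (- K * norm (z - p)) \<le> (g z - g p - ereal (\<zeta> \<bullet> (z - p))) / ereal (norm (z - p))"
      by (auto simp: eventually_at_filter)
  qed
  ultimately show ?thesis by (simp add: regular_subdiff_def fin)
qed

lemma regular_imp_limiting_subdiff:
  "\<zeta> \<in> regular_subdiff g p \<Longrightarrow> \<zeta> \<in> limiting_subdiff g p"
  unfolding limiting_subdiff_def mem_Collect_eq
  by (intro conjI exI[of _ "\<lambda>_. p"] exI[of _ "\<lambda>_. \<zeta>"]) (auto simp: regular_subdiff_def)

section \<open>Convex functions with Lipschitz gradient\<close>

lemma has_derivative_along_line:
  fixes f :: "'a::real_inner \<Rightarrow> real"
  assumes "\<And>z. GDERIV f z :> gf z"
  shows "((\<lambda>t. f (p + t *\<^sub>R d)) has_real_derivative gf (p + t *\<^sub>R d) \<bullet> d) (at t)"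
proof -
  have "((\<lambda>t. p + t *\<^sub>R d) has_derivative (\<lambda>h. h *\<^sub>R d)) (at t)"
    by (auto intro!: derivative_eq_intros)
  from has_derivative_compose[OF this assms[unfolded gderiv_def]]
  show ?thesis
    by (simp add: has_field_derivative_def inner_commute mult_commute_abs)
qed

lemma convex_gradient_inequality:
  fixes f :: "'a::real_inner \<Rightarrow> real"
  assumes f: "convex_on UNIV f" and grad: "\<And>z. GDERIV f z :> gf z"
  shows "f p + gf p \<bullet> (z - p) \<le> f z"
proof -
  let ?h = "\<lambda>t. f (p + t *\<^sub>R (z - p))"
  have "convex_on UNIV ?h"
  proof (rule convex_onI)
    fix t a b :: real assume t: "0 < t" "t < 1"
    have "p + ((1 - t) *\<^sub>R a + t *\<^sub>R b) *\<^sub>R (z - p)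
        = (1 - t) *\<^sub>R (p + a *\<^sub>R (z - p)) + t *\<^sub>R (p + b *\<^sub>R (z - p))"
      by (simp add: algebra_simps)
    then show "?h ((1 - t) *\<^sub>R a + t *\<^sub>R b) \<le> (1 - t) * ?h a + t * ?h b"
      using convex_onD[OF f, of t "p + a *\<^sub>R (z - p)" "p + b *\<^sub>R (z - p)"] t by simp
  qed simp
  moreover have "(?h has_real_derivative gf p \<bullet> (z - p)) (at 0)"
    using has_derivative_along_line[OF grad, of p "z - p" 0] by simp
  ultimately have "gf p \<bullet> (z - p) * (1 - 0) \<le> ?h 1 - ?h 0"
    by (intro convex_on_imp_above_tangent[of UNIV]) auto
  then show ?thesis by simp
qed

text \<open>Along the segment from \<open>p\<close> to \<open>z\<close>, the difference of the two sides has a derivative of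
  constant sign because the gradient changes by at most \<open>L * t * \<parallel>z - p\<parallel>\<close>.\<close>

lemma descent_lemma:
  fixes f :: "'a::real_inner \<Rightarrow> real"
  assumes grad: "\<And>z. GDERIV f z :> gf z" and lip: "L-lipschitz_on UNIV gf"
  shows "f z \<le> f p + gf p \<bullet> (z - p) + L / 2 * (norm (z - p))\<^sup>2"
proof -
  let ?d = "z - p"
  define h where "h t = f (p + t *\<^sub>R ?d) - t * (gf p \<bullet> ?d) - L / 2 * (norm ?d)\<^sup>2 * t\<^sup>2" for t
  have "h 1 \<le> h 0"
  proof (rule DERIV_nonpos_imp_nonincreasing[where f = h])
    fix t :: real assume t: "0 \<le> t" "t \<le> 1"
    have "(gf (p + t *\<^sub>R ?d) - gf p) \<bullet> ?d \<le> norm (gf (p + t *\<^sub>R ?d) - gf p) * norm ?d"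
      by (rule norm_cauchy_schwarz)
    also have "\<dots> \<le> L * (t * norm ?d) * norm ?d"
      using lipschitz_onD[OF lip, of "p + t *\<^sub>R ?d" p] t
      by (intro mult_right_mono) (auto simp: dist_norm)
    finally have "gf (p + t *\<^sub>R ?d) \<bullet> ?d - gf p \<bullet> ?d - L * (norm ?d)\<^sup>2 * t \<le> 0"
      by (simp add: inner_diff_left power2_eq_square algebra_simps)
    moreover have "(h has_real_derivative
        gf (p + t *\<^sub>R ?d) \<bullet> ?d - 1 * (gf p \<bullet> ?d) - L / 2 * (norm ?d)\<^sup>2 * (2 * t)) (at t)"
      unfolding h_def
      by (intro DERIV_diff has_derivative_along_line[OF grad] DERIV_cmult DERIV_cmult_right DERIV_ident)
        (auto intro!: derivative_eq_intros)
    ultimately show "\<exists>y. (h has_real_derivative y) (at t) \<and> y \<le> 0"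
      by (intro exI conjI) auto
  qed simp
  then show ?thesis by (simp add: h_def)
qed

text \<open>First-order optimality without differentiating \<open>q\<close>: moving from the minimizer a fraction \<open>t\<close>
  of the way towards \<open>z\<close> does not decrease the objective; divide by \<open>t\<close> and let \<open>t\<close> tend to 0.\<close>

lemma proximal_step_variational_inequality:
  fixes q :: "'a::real_inner \<Rightarrow> real"
  assumes q: "convex_on C q"
    and min: "is_arg_min (\<lambda>z. q z + L / 2 * (norm (z - y))\<^sup>2) (\<lambda>z. z \<in> C) p"
    and z: "z \<in> C"
  shows "0 \<le> q z - q p + L * ((p - y) \<bullet> (z - p))"
proof -
  let ?A = "q z - q p + L * ((p - y) \<bullet> (z - p))" and ?B = "L / 2 * (norm (z - p))\<^sup>2"
  have p: "p \<in> C" and le: "\<And>w. w \<in> C \<Longrightarrow> q p + L / 2 * (norm (p - y))\<^sup>2 \<le> q w + L / 2 * (norm (w - y))\<^sup>2"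
    using min by (auto simp: is_arg_min_def not_less)
  have "0 \<le> ?A + t * ?B" if t: "0 < t" "t \<le> 1" for t
  proof -
    define w where "w = (1 - t) *\<^sub>R p + t *\<^sub>R z"
    have "w \<in> C" unfolding w_def using q p z t by (auto intro!: convexD simp: convex_on_def)
    have wy: "w - y = (p - y) + t *\<^sub>R (z - p)" by (simp add: w_def algebra_simps)
    have "(norm (w - y))\<^sup>2 = (norm (p - y))\<^sup>2 + 2 * t * ((p - y) \<bullet> (z - p)) + t\<^sup>2 * (norm (z - p))\<^sup>2"
      unfolding wy power2_norm_eq_inner
      by (simp add: inner_add_left inner_add_right inner_commute power2_eq_square)
    moreover have "q w \<le> (1 - t) * q p + t * q z"
      unfolding w_def using convex_onD[OF q, of t p z] p z t by auto
    moreover note le[OF \<open>w \<in> C\<close>]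
    ultimately have "q p + L / 2 * (norm (p - y))\<^sup>2 \<le> (1 - t) * q p + t * q z
        + L / 2 * ((norm (p - y))\<^sup>2 + 2 * t * ((p - y) \<bullet> (z - p)) + t\<^sup>2 * (norm (z - p))\<^sup>2)"
      by simp
    then have "0 \<le> t * (?A + t * ?B)" by (simp add: algebra_simps power2_eq_square)
    then show ?thesis using t by (simp add: zero_le_mult_iff)
  qed
  then have "\<forall>\<^sub>F t in at_right 0. 0 \<le> ?A + t * ?B"
    unfolding eventually_at_right_field by (intro exI[of _ 1]) auto
  moreover have "((\<lambda>t. ?A + t * ?B) \<longlongrightarrow> ?A + 0 * ?B) (at_right 0)"
    by (intro tendsto_intros)
  ultimately show ?thesis
    using tendsto_lowerbound[of "\<lambda>t. ?A + t * ?B" ?A "at_right 0" 0] by simp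
qed

section \<open>Right derivatives of concave functions\<close>

lemma concave_supergradient:
  fixes \<phi> :: "real \<Rightarrow> real"
  assumes "concave_on A \<phi>" "u \<in> interior A" "v \<in> A" "(\<phi> has_real_derivative D) (at u)"
  shows "\<phi> v \<le> \<phi> u + D * (v - u)"
proof -
  have "- D * (v - u) \<le> - \<phi> v - - \<phi> u"
  proof (rule convex_on_imp_above_tangent)
    show "convex_on A (\<lambda>x. - \<phi> x)" "u \<in> interior A" "v \<in> A"
      using assms by (auto simp: concave_on_def)
    show "connected A"
      using assms(1) concave_on_imp_convex convex_connected by blast
    show "((\<lambda>x. - \<phi> x) has_real_derivative - D) (at u within A)"
      using assms(4) by (intro DERIV_minus) (rule has_field_derivative_at_within)
  qed
  then show ?thesis by simp
qed

lemma C1_real_has_deriv: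
  assumes "\<phi> C1_differentiable_on S" "u \<in> S"
  shows "(\<phi> has_real_derivative deriv \<phi> u) (at u)"
  using assms DERIV_deriv_iff_has_field_derivative
  by (auto simp: C1_differentiable_on_def simp flip: has_real_derivative_iff_has_vector_derivative)

text \<open>At an interior point the right derivative is the derivative. At 0, l'Hopital's rule shows that
  the difference quotients converge to the limit of the derivatives, and concavity makes them
  decreasing in the increment, so their limit dominates each of them.\<close>

lemma right_deriv_supergradient:
  fixes \<phi> :: "real \<Rightarrow> real"
  assumes cont: "continuous_on {0..} \<phi>" and conc: "concave_on {0..} \<phi>"
    and C1: "\<phi> C1_differentiable_on {0<..}" and lim: "(deriv \<phi> \<longlongrightarrow> l) (at_right 0)"
    and u: "0 \<le> u" and v: "0 \<le> v"
  shows "\<phi> v \<le> \<phi> u + right_deriv \<phi> u * (v - u)"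
proof (cases "u = 0")
  case False
  with u have u: "u > 0" by simp
  have d: "(\<phi> has_real_derivative deriv \<phi> u) (at u)"
    using C1_real_has_deriv[OF C1] u by simp
  then have "((\<lambda>h. (\<phi> (u + h) - \<phi> u) / h) \<longlongrightarrow> deriv \<phi> u) (at 0)"
    by (simp add: DERIV_def)
  then have "((\<lambda>h. (\<phi> (u + h) - \<phi> u) / h) \<longlongrightarrow> deriv \<phi> u) (at_right 0)"
    by (rule tendsto_within_subset) simp
  then have "right_deriv \<phi> u = deriv \<phi> u"
    unfolding right_deriv_def by (intro tendsto_Lim) auto
  then show ?thesis
    using concave_supergradient[OF conc _ _ d, of v] u v by simp
next
  case True
  let ?q = "\<lambda>h. (\<phi> h - \<phi> 0) / h"
  have "(?q \<longlongrightarrow> l) (at_right 0)"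
  proof (rule lhopital_right_0[where f' = "deriv \<phi>" and g' = "\<lambda>_. 1"])
    have "(\<phi> \<longlongrightarrow> \<phi> 0) (at 0 within {0..})"
      using cont by (auto simp: continuous_on_def)
    then have "(\<phi> \<longlongrightarrow> \<phi> 0) (at_right 0)"
      by (rule tendsto_within_subset) auto
    then show "((\<lambda>h. \<phi> h - \<phi> 0) \<longlongrightarrow> 0) (at_right 0)"
      by (simp add: LIM_zero_iff)
    show "\<forall>\<^sub>F h in at_right 0. ((\<lambda>h. \<phi> h - \<phi> 0) has_real_derivative deriv \<phi> h) (at h)"
      using C1_real_has_deriv[OF C1]
      by (auto simp: eventually_at_filter intro!: always_eventually derivative_eq_intros)
    show "((\<lambda>h. deriv \<phi> h / 1) \<longlongrightarrow> l) (at_right 0)" using lim by simp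
  qed (auto simp: eventually_at_filter)
  moreover from this have "right_deriv \<phi> 0 = l"
    unfolding right_deriv_def by (intro tendsto_Lim) auto
  moreover have "?q v \<le> ?q h" if "0 < h" "h < v" for h
  proof -
    have "(1 - h / v) * \<phi> 0 + h / v * \<phi> v \<le> \<phi> ((1 - h / v) *\<^sub>R 0 + (h / v) *\<^sub>R v)"
      using that by (intro concave_onD[OF conc]) auto
    then show ?thesis using that by (simp add: field_simps)
  qed
  then have "\<forall>\<^sub>F h in at_right 0. ?q v \<le> ?q h" if "v > 0"
    using that unfolding eventually_at_right_field by (intro exI[of _ v]) auto
  ultimately have "?q v \<le> right_deriv \<phi> 0" if "v > 0"
    using that tendsto_lowerbound[of ?q l "at_right 0" "?q v"] by simp
  then show ?thesis
    using True v by (cases "v = 0") (auto simp: field_simps)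
qed

text \<open>A negative supergradient would force \<open>\<phi>\<close> below 0 far to the right.\<close>

lemma right_deriv_nonneg:
  assumes "\<And>v. 0 \<le> v \<Longrightarrow> 0 \<le> \<phi> v" "\<And>v. 0 \<le> v \<Longrightarrow> \<phi> v \<le> \<phi> u + s * (v - u)" "0 \<le> u"
  shows "0 \<le> (s :: real)"
proof (rule ccontr)
  assume "\<not> 0 \<le> s"
  then have s: "s < 0" by simp
  define v where "v = u - (\<phi> u + 1) / s"
  have "0 \<le> v" using s assms(1)[OF assms(3)] assms(3)
    by (simp add: v_def divide_nonneg_neg order.trans[of _ 0])
  moreover have "s * (v - u) = - (\<phi> u + 1)" using s by (simp add: v_def)
  ultimately show False using assms(1)[of v] assms(2)[of v] by simp
qed

section \<open>Finite length from the Kurdyka-Lojasiewicz inequality\<close>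

lemma desingularizer_supergradient:
  assumes "\<psi> \<in> desingularizers a" "0 < t" "ereal t < a" "0 \<le> s" "ereal s < a"
  shows "\<psi> s \<le> \<psi> t + deriv \<psi> t * (s - t)"
proof (rule concave_supergradient)
  show "concave_on {t. 0 \<le> t \<and> ereal t < a} \<psi>"
    using assms(1) by (simp add: desingularizers_def)
  show "t \<in> interior {t. 0 \<le> t \<and> ereal t < a}"
  proof (rule interiorI)
    show "open {t. 0 < t \<and> ereal t < a}"
      by (intro open_Collect_conj open_Collect_less continuous_intros continuous_on_ereal)
  qed (use assms in auto)
  show "(\<psi> has_real_derivative deriv \<psi> t) (at t)"
    using assms by (intro C1_real_has_deriv[of _ "{t. 0 < t \<and> ereal t < a}"])
      (auto simp: desingularizers_def)
qed (use assms in auto)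

text \<open>Here \<open>d\<close> is the new and \<open>e\<close> the old step, \<open>r\<close> and \<open>r'\<close> are the gaps to the limit value before
  and after the new step, and \<open>c * (d + e)\<close> bounds the distance of 0 from the subdifferential.
  Concavity of \<open>\<psi>\<close> converts the decrease \<open>D * d\<^sup>2\<close> of the gap into a decrease
  of \<open>\<psi>\<close> by at least \<open>deriv \<psi> r * D * d\<^sup>2\<close>, which by the KL inequality is at least
  \<open>D * d\<^sup>2 / (c * (d + e))\<close>; the arithmetic-geometric mean inequality linearizes the
  resulting bound on \<open>d\<^sup>2\<close>. If the gap is already 0, descent forces \<open>d = 0\<close>, so finite
  termination needs no separate treatment later on.\<close>

lemma KL_step_bound:
  fixes d e :: real
  assumes D: "0 < D" and c: "0 \<le> c" and d: "0 \<le> d" and e: "0 \<le> e"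
    and descent: "r' \<le> r - D * d\<^sup>2" and r': "0 \<le> r'" and ra: "ereal r < a"
    and \<psi>: "\<psi> \<in> desingularizers a"
    and KL: "0 < r \<Longrightarrow> 1 \<le> deriv \<psi> r * (c * (d + e))"
  shows "d \<le> e / 3 + 4 * c / (3 * D) * (\<psi> r - \<psi> r')"
proof (cases "0 < r")
  case False
  have "0 \<le> D * d\<^sup>2" using D by simp
  with False descent r' have "r = 0" "r' = 0" "D * d\<^sup>2 = 0" by linarith+
  with D have "d = 0" by simp
  with \<open>r = 0\<close> \<open>r' = 0\<close> e show ?thesis by simp
next
  case True
  let ?\<Delta> = "\<psi> r - \<psi> r'"
  have "0 \<le> D * d\<^sup>2" using D by simp
  then have "r' \<le> r" using descent by simp
  then have "ereal r' < a" using ra by (meson ereal_less_eq(3) le_less_trans)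
  then have "\<psi> r' \<le> \<psi> r + deriv \<psi> r * (r' - r)"
    using desingularizer_supergradient[OF \<psi> True ra r'] by simp
  moreover have \<psi>': "0 < deriv \<psi> r" using \<psi> True ra by (auto simp: desingularizers_def)
  then have "deriv \<psi> r * (D * d\<^sup>2) \<le> deriv \<psi> r * (r - r')"
    using descent by (intro mult_left_mono) auto
  ultimately have gain: "deriv \<psi> r * (D * d\<^sup>2) \<le> ?\<Delta>" by (simp add: algebra_simps)
  have "0 \<le> deriv \<psi> r * (D * d\<^sup>2)" using \<psi>' D by simp
  then have \<Delta>: "0 \<le> ?\<Delta>" using gain by linarith
  have square_le: "4 * s * t \<le> (s + t)\<^sup>2" for s t :: real
    using zero_le_power2[of "s - t"] by (simp add: power2_eq_square algebra_simps)
  have "D * d\<^sup>2 \<le> deriv \<psi> r * (c * (d + e)) * (D * d\<^sup>2)"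
    using mult_right_mono[OF KL[OF True], of "D * d\<^sup>2"] D by simp
  also have "\<dots> = c * (d + e) * (deriv \<psi> r * (D * d\<^sup>2))" by (simp add: mult_ac)
  also have "\<dots> \<le> c * (d + e) * ?\<Delta>"
    using gain c d e by (intro mult_left_mono) auto
  finally have "d\<^sup>2 \<le> (d + e) * (c * ?\<Delta> / D)"
    using D by (simp add: field_simps)
  \<comment> \<open>Splitting the product with the weight 1/4 leaves \<open>e\<close> with the coefficient 1/3 once
    \<open>d\<close> is absorbed on the left; the argument at the cluster point needs a coefficient below 1.\<close>
  also have "\<dots> = 4 * ((d + e) / 4) * (c * ?\<Delta> / D)"
    using D by (simp add: field_simps)
  also have "\<dots> \<le> ((d + e) / 4 + c * ?\<Delta> / D)\<^sup>2"
    using square_le by blast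
  finally have "d \<le> (d + e) / 4 + c * ?\<Delta> / D"
    using power2_le_imp_le c D \<Delta> d e by (auto intro!: add_nonneg_nonneg)
  then show ?thesis using D by (simp add: field_simps)
qed

lemma descent_imp_steps_vanish:
  fixes d r :: "nat \<Rightarrow> real"
  assumes D: "0 < D" and descent: "\<And>k. r (Suc k) \<le> r k - D * (d k)\<^sup>2" and r: "r \<longlonglongrightarrow> r'"
  shows "d \<longlonglongrightarrow> 0"
proof -
  have "(\<lambda>k. (d k)\<^sup>2) \<longlonglongrightarrow> 0"
  proof (rule tendsto_sandwich[where f = "\<lambda>_. 0"])
    have "(\<lambda>k. (r k - r (Suc k)) / D) \<longlonglongrightarrow> (r' - r') / D"
      using D r by (intro tendsto_intros LIMSEQ_Suc) auto
    then show "(\<lambda>k. (r k - r (Suc k)) / D) \<longlonglongrightarrow> 0" by simp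
    show "\<forall>\<^sub>F k in sequentially. (d k)\<^sup>2 \<le> (r k - r (Suc k)) / D"
      using descent D by (intro always_eventually allI) (simp add: field_simps)
  qed auto
  then show ?thesis by simp
qed

text \<open>The KL hypothesis is only available while the iterates stay within \<open>\<rho>\<close> of \<open>p\<close>. Starting at an
  index \<open>N\<close> for which \<open>x (N + 1)\<close> is close to \<open>p\<close> and the steps and \<open>\<psi> (r (N + 1))\<close> are
  small, the sum of two thirds of the length travelled so far, a third of the current step and a
  multiple of the current value of \<open>\<psi>\<close> never increases. This keeps the iterates in the
  neighbourhood, which in turn justifies the next step of the induction.\<close>

lemma KL_finite_length:
  fixes x :: "nat \<Rightarrow> 'a::real_normed_vector"
  defines "d \<equiv> \<lambda>k. norm (x (Suc k) - x k)"
  assumes D: "0 < D" and c: "0 \<le> c" and a: "0 < a" and \<rho>: "0 < \<rho>"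
    and descent: "\<And>k. r (Suc k) \<le> r k - D * (d k)\<^sup>2"
    and r: "\<And>k. 0 \<le> r k" "r \<longlonglongrightarrow> 0"
    and cluster: "strict_mono \<sigma>" "(x \<circ> \<sigma>) \<longlonglongrightarrow> p"
    and \<psi>: "\<psi> \<in> desingularizers a"
    and KL: "\<And>k. \<lbrakk>dist (x (Suc k)) p < \<rho>; dist (x (Suc (Suc k))) p < \<rho>; 0 < r (Suc k);
        ereal (r (Suc k)) < a\<rbrakk> \<Longrightarrow> 1 \<le> deriv \<psi> (r (Suc k)) * (c * (d (Suc k) + d k))"
  shows "summable d"
proof -
  have dnn: "0 \<le> d k" for k by (simp add: d_def)
  have d0: "d \<longlonglongrightarrow> 0" by (rule descent_imp_steps_vanish[OF D descent r(2)])
  have small: "\<forall>\<^sub>F k in sequentially. ereal (r k) < a"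
  proof -
    have "(\<lambda>k. ereal (r k)) \<longlonglongrightarrow> 0" using r(2) by (simp add: zero_ereal_def)
    then show ?thesis using a by (rule order_tendstoD)
  qed
  have "(\<lambda>k. \<psi> (r k)) \<longlonglongrightarrow> \<psi> 0"
  proof (rule continuous_on_tendsto_compose[of "{t. 0 \<le> t \<and> ereal t < a}" \<psi> r])
    show "continuous_on {t. 0 \<le> t \<and> ereal t < a} \<psi>" using \<psi> by (simp add: desingularizers_def)
    show "\<forall>\<^sub>F k in sequentially. r k \<in> {t. 0 \<le> t \<and> ereal t < a}"
      using small r(1) by (auto elim: eventually_mono)
  qed (use r a in \<open>auto simp: zero_ereal_def\<close>)
  then have \<psi>0: "(\<lambda>k. \<psi> (r k)) \<longlonglongrightarrow> 0" using \<psi> by (simp add: desingularizers_def)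
  define K where "K = 4 * c / (3 * D)"
  have K: "0 \<le> K" using c D by (simp add: K_def)
  have "(\<lambda>k. d k / 2 + 3 / 2 * (K * \<psi> (r (Suc k)))) \<longlonglongrightarrow> 0 / 2 + 3 / 2 * (K * 0)"
    by (intro tendsto_intros d0 LIMSEQ_Suc[OF \<psi>0]) simp
  then have e1: "\<forall>\<^sub>F k in sequentially. d k / 2 + 3 / 2 * (K * \<psi> (r (Suc k))) < \<rho> / 4"
    using \<rho> by (intro order_tendstoD) auto
  have e2: "\<forall>\<^sub>F k in sequentially. d k < \<rho> / 4"
    using d0 \<rho> by (intro order_tendstoD) auto
  obtain N0 where N0: "\<And>k. N0 \<le> k \<Longrightarrow> d k / 2 + 3 / 2 * (K * \<psi> (r (Suc k))) < \<rho> / 4"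
    "\<And>k. N0 \<le> k \<Longrightarrow> d k < \<rho> / 4" "\<And>k. N0 \<le> k \<Longrightarrow> ereal (r k) < a"
    using eventually_conj[OF e1 eventually_conj[OF e2 small]] unfolding eventually_sequentially by auto
  have "(\<lambda>j. (x (Suc (\<sigma> j)) - x (\<sigma> j)) + x (\<sigma> j)) \<longlonglongrightarrow> 0 + p"
    using LIMSEQ_subseq_LIMSEQ[OF d0 cluster(1)] cluster(2)
    by (intro tendsto_add) (simp_all add: o_def d_def tendsto_norm_zero_iff)
  then have "(\<lambda>j. x (Suc (\<sigma> j))) \<longlonglongrightarrow> p" by simp
  then have "\<forall>\<^sub>F j in sequentially. dist (x (Suc (\<sigma> j))) p < \<rho> / 4"
    using \<rho> by (intro tendstoD) auto
  then obtain j where j: "N0 \<le> j" "dist (x (Suc (\<sigma> j))) p < \<rho> / 4"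
    unfolding eventually_sequentially using nat_le_linear by blast
  define N where "N = \<sigma> j"
  have N: "N0 \<le> N" "dist (x (Suc N)) p < \<rho> / 4"
    using j seq_suble[OF cluster(1), of j] by (auto simp: N_def)
  define S where "S m = (\<Sum>k<m. d (Suc N + k))" for m
  define B where "B = d N / 2 + 3 / 2 * (K * \<psi> (r (Suc N)))"
  have \<psi>nn: "0 \<le> \<psi> (r k)" if "N0 \<le> k" for k
    using N0(3)[OF that] r(1)[of k] \<psi> by (auto simp: desingularizers_def)
  have dist: "dist (x (Suc N + m)) p < \<rho> / 4 + S m" for m
  proof (induction m)
    case 0
    then show ?case using N by (simp add: S_def)
  next
    case (Suc m)
    have "dist (x (Suc N + Suc m)) p \<le> d (Suc N + m) + dist (x (Suc N + m)) p"
      using dist_triangle[of "x (Suc N + Suc m)" p "x (Suc N + m)"] by (simp add: d_def dist_norm)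
    then show ?case using Suc by (simp add: S_def)
  qed
  have pot: "2 / 3 * S m + d (N + m) / 3 + K * \<psi> (r (Suc N + m)) \<le> 2 / 3 * B" for m
  proof (induction m)
    case 0
    then show ?case by (simp add: S_def B_def)
  next
    case (Suc m)
    have "0 \<le> K * \<psi> (r (Suc N + m))" using K \<psi>nn N by simp
    then have "S m \<le> B" using Suc dnn[of "N + m"] by simp
    moreover have "B < \<rho> / 4" using N0(1) N by (simp add: B_def)
    moreover have "d (Suc N + m) < \<rho> / 4" using N0(2) N by simp
    moreover have "S (Suc m) = S m + d (Suc N + m)" by (simp add: S_def)
    ultimately have "dist (x (Suc (N + m))) p < \<rho>" "dist (x (Suc (Suc (N + m)))) p < \<rho>"
      using dist[of m] dist[of "Suc m"] \<rho> by auto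
    then have "d (Suc (N + m)) \<le> d (N + m) / 3
        + K * (\<psi> (r (Suc (N + m))) - \<psi> (r (Suc (Suc (N + m)))))"
      unfolding K_def using D c dnn r(1) N0(3) N
      by (intro KL_step_bound[OF _ _ _ _ descent _ _ \<psi> KL]) auto
    then show ?case
      using Suc by (simp add: S_def algebra_simps)
  qed
  have "S m \<le> B" for m
  proof -
    have "0 \<le> K * \<psi> (r (Suc N + m))" using K \<psi>nn N by simp
    then show ?thesis using pot[of m] dnn[of "N + m"] by simp
  qed
  then have "summable (\<lambda>k. d (Suc N + k))"
    unfolding S_def by (intro summableI_nonneg_bounded[of _ B]) (auto simp: dnn)
  then show ?thesis
    using summable_iff_shift[of d "Suc N"] by (simp add: add.commute)
qed

section \<open>One iteration of the reweighted algorithm\<close>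

text \<open>The finite part of the objective: the value \<open>\<infinity>\<close> then only records that a point lies
  outside \<open>C\<close>.\<close>

definition unconstrained_objective :: "(real ^ 'n \<Rightarrow> real) \<Rightarrow> (real \<Rightarrow> real) \<Rightarrow> real ^ 'n \<Rightarrow> real" where
  "unconstrained_objective f \<phi> z = f z + separable_sum \<phi> (vec_abs z)"

lemma objective_eq:
  "objective f C \<phi> z = (if z \<in> C then ereal (unconstrained_objective f \<phi> z) else \<infinity>)"
  by (simp add: objective_def indicator_fun_def unconstrained_objective_def)

lemma H1_eq:
  "H1 L f C \<phi> (z, w) =
    (if z \<in> C then ereal (unconstrained_objective f \<phi> z + L / 2 * (norm (z - w))\<^sup>2) else \<infinity>)"
  by (simp add: H1_def indicator_fun_def unconstrained_objective_def)

lemma continuous_on_unconstrained_objective: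
  assumes f: "continuous_on UNIV f" and \<phi>: "continuous_on {0..} \<phi>"
  shows "continuous_on UNIV (unconstrained_objective f \<phi>)"
proof -
  have "continuous_on UNIV (\<lambda>z :: real ^ 'n. \<phi> \<bar>z $ i\<bar>)" for i
    by (rule continuous_on_compose2[OF \<phi>]) (auto intro!: continuous_intros)
  then show ?thesis
    unfolding unconstrained_objective_def separable_sum_def vec_abs_def
    using f by (auto intro!: continuous_intros)
qed

lemma convex_on_weighted_l1:
  fixes a s :: "real ^ 'n"
  assumes "\<And>i. 0 \<le> s $ i" "convex C"
  shows "convex_on C (\<lambda>z. a \<bullet> (z - y) + (\<Sum>i\<in>UNIV. s $ i * \<bar>z $ i\<bar>))"
proof (rule convex_onI)
  fix t :: real and v w :: "real ^ 'n" assume t: "0 < t" "t < 1"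
  have "s $ i * \<bar>((1 - t) *\<^sub>R v + t *\<^sub>R w) $ i\<bar>
      \<le> (1 - t) * (s $ i * \<bar>v $ i\<bar>) + t * (s $ i * \<bar>w $ i\<bar>)" for i
  proof -
    have "\<bar>(1 - t) * v $ i + t * w $ i\<bar> \<le> (1 - t) * \<bar>v $ i\<bar> + t * \<bar>w $ i\<bar>"
      using abs_triangle_ineq[of "(1 - t) * v $ i" "t * w $ i"] t by (simp add: abs_mult)
    from mult_left_mono[OF this assms(1)[of i]] show ?thesis by (simp add: algebra_simps)
  qed
  then have "(\<Sum>i\<in>UNIV. s $ i * \<bar>((1 - t) *\<^sub>R v + t *\<^sub>R w) $ i\<bar>)
      \<le> (\<Sum>i\<in>UNIV. (1 - t) * (s $ i * \<bar>v $ i\<bar>) + t * (s $ i * \<bar>w $ i\<bar>))"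
    by (rule sum_mono)
  also have "\<dots> = (1 - t) * (\<Sum>i\<in>UNIV. s $ i * \<bar>v $ i\<bar>) + t * (\<Sum>i\<in>UNIV. s $ i * \<bar>w $ i\<bar>)"
    by (simp add: sum.distrib sum_distrib_left)
  finally show "a \<bullet> ((1 - t) *\<^sub>R v + t *\<^sub>R w - y) + (\<Sum>i\<in>UNIV. s $ i * \<bar>((1 - t) *\<^sub>R v + t *\<^sub>R w) $ i\<bar>)
     \<le> (1 - t) * (a \<bullet> (v - y) + (\<Sum>i\<in>UNIV. s $ i * \<bar>v $ i\<bar>)) +
       t * (a \<bullet> (w - y) + (\<Sum>i\<in>UNIV. s $ i * \<bar>w $ i\<bar>))"
    by (simp add: algebra_simps inner_diff_right inner_add_right)
qed (rule assms)

lemma reweighted_l1_variational_inequality: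
  fixes a s :: "real ^ 'n"
  assumes s: "\<And>i. 0 \<le> s $ i" and C: "convex C"
    and min: "is_arg_min (\<lambda>z. a \<bullet> (z - y) + L / 2 * (norm (z - y))\<^sup>2 + (\<Sum>i\<in>UNIV. s $ i * \<bar>z $ i\<bar>))
       (\<lambda>z. z \<in> C) p"
    and z: "z \<in> C"
  shows "0 \<le> (a + L *\<^sub>R (p - y)) \<bullet> (z - p) + (\<Sum>i\<in>UNIV. s $ i * (\<bar>z $ i\<bar> - \<bar>p $ i\<bar>))"
proof -
  let ?q = "\<lambda>z. a \<bullet> (z - y) + (\<Sum>i\<in>UNIV. s $ i * \<bar>z $ i\<bar>)"
  have "is_arg_min (\<lambda>z. ?q z + L / 2 * (norm (z - y))\<^sup>2) (\<lambda>z. z \<in> C) p"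
    using min by (simp add: add_ac)
  from proximal_step_variational_inequality[OF convex_on_weighted_l1[OF s C] this z]
  have "0 \<le> ?q z - ?q p + L * ((p - y) \<bullet> (z - p))" .
  then show ?thesis
    by (simp add: algebra_simps sum_subtractf inner_diff_right inner_add_left)
qed

text \<open>The optimality condition is tested with the old iterate \<open>w\<close>. Its quadratic terms combine through
  \<open>\<parallel>w - y\<parallel>\<^sup>2 = \<parallel>p - y\<parallel>\<^sup>2 + 2 * ((p - y) \<bullet> (w - p)) + \<parallel>p - w\<parallel>\<^sup>2\<close>, and the term \<open>\<parallel>p - y\<parallel>\<^sup>2\<close>
  cancels against the one in the quadratic upper model of \<open>f\<close>.\<close>

lemma IRL_step_descent:
  fixes f :: "real ^ 'n \<Rightarrow> real" and \<phi> :: "real \<Rightarrow> real" and w :: "real ^ 'n"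
  defines "s \<equiv> separable_right_deriv \<phi> (vec_abs w)"
  assumes convex: "convex_on UNIV f" and grad: "\<And>z. GDERIV f z :> gf z"
    and lip: "L-lipschitz_on UNIV gf"
    and phi: "\<And>u v. 0 \<le> u \<Longrightarrow> 0 \<le> v \<Longrightarrow> \<phi> v \<le> \<phi> u + right_deriv \<phi> u * (v - u)"
    and s: "\<And>i. 0 \<le> s $ i" and C: "convex C" and w: "w \<in> C"
    and min: "is_arg_min (\<lambda>z. gf y \<bullet> (z - y) + L / 2 * (norm (z - y))\<^sup>2 + (\<Sum>i\<in>UNIV. s $ i * \<bar>z $ i\<bar>))
       (\<lambda>z. z \<in> C) p"
  shows "unconstrained_objective f \<phi> p + L / 2 * (norm (p - w))\<^sup>2
    \<le> unconstrained_objective f \<phi> w + L / 2 * (norm (w - y))\<^sup>2"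
proof -
  have "0 \<le> (gf y + L *\<^sub>R (p - y)) \<bullet> (w - p) + (\<Sum>i\<in>UNIV. s $ i * (\<bar>w $ i\<bar> - \<bar>p $ i\<bar>))"
    by (rule reweighted_l1_variational_inequality[OF s C min w])
  moreover have "f p \<le> f y + gf y \<bullet> (p - y) + L / 2 * (norm (p - y))\<^sup>2"
    by (rule descent_lemma[OF grad lip])
  moreover have "f y + gf y \<bullet> (w - y) \<le> f w"
    by (rule convex_gradient_inequality[OF convex grad])
  moreover have "separable_sum \<phi> (vec_abs p)
      \<le> separable_sum \<phi> (vec_abs w) - (\<Sum>i\<in>UNIV. s $ i * (\<bar>w $ i\<bar> - \<bar>p $ i\<bar>))"
  proof -
    have "separable_sum \<phi> (vec_abs p) \<le> (\<Sum>i\<in>UNIV. \<phi> \<bar>w $ i\<bar> + s $ i * (\<bar>p $ i\<bar> - \<bar>w $ i\<bar>))"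
      unfolding separable_sum_def s_def separable_right_deriv_def vec_abs_def
      by (auto intro!: sum_mono phi)
    then show ?thesis
      by (simp add: separable_sum_def vec_abs_def algebra_simps sum.distrib sum_subtractf)
  qed
  moreover have "(norm (w - y))\<^sup>2 = (norm (p - y))\<^sup>2 + 2 * ((p - y) \<bullet> (w - p)) + (norm (p - w))\<^sup>2"
    unfolding power2_norm_eq_inner by (simp add: inner_diff_left inner_diff_right inner_commute)
  then have "L / 2 * (norm (w - y))\<^sup>2
      = L / 2 * (norm (p - y))\<^sup>2 + (L *\<^sub>R (p - y)) \<bullet> (w - p) + L / 2 * (norm (p - w))\<^sup>2"
    by (simp add: distrib_left)
  moreover have "gf y \<bullet> (w - y) = gf y \<bullet> (p - y) + gf y \<bullet> (w - p)"
    by (simp add: inner_diff_right)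
  ultimately show ?thesis
    unfolding unconstrained_objective_def inner_add_left by linarith
qed

text \<open>The vector \<open>t\<close> of weights and the gradient are taken at the new point \<open>p\<close>, whereas the optimality condition
  involves the weights \<open>s\<close> at \<open>w\<close> and the gradient at \<open>y\<close>. The discrepancy is Lipschitz in \<open>z - p\<close> with
  the constant stated for \<open>\<eta>\<close>, so the convex function with the correct data has a conic minorant of
  that slope and hence a subgradient \<open>\<eta>\<close> of that size. Passing from the linearized penalty back to
  \<open>\<phi>\<close> uses the tangent of \<open>\<phi>\<close> at the entries of \<open>z\<close>, whose slope differs from the one at the entries of
  \<open>p\<close> by at most \<open>M\<close> times the distance: a quadratic loss.\<close>

lemma IRL_step_proximal_subgradient:
  fixes f :: "real ^ 'n \<Rightarrow> real" and \<phi> :: "real \<Rightarrow> real" and w :: "real ^ 'n" and M :: real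
  defines "s \<equiv> separable_right_deriv \<phi> (vec_abs w)"
  assumes convex: "convex_on UNIV f" and grad: "\<And>z. GDERIV f z :> gf z" and L: "0 \<le> L"
    and lip: "L-lipschitz_on UNIV gf"
    and phi: "\<And>u v. 0 \<le> u \<Longrightarrow> 0 \<le> v \<Longrightarrow> \<phi> v \<le> \<phi> u + right_deriv \<phi> u * (v - u)"
    and phi_lip: "M-lipschitz_on {0..} (right_deriv \<phi>)"
    and nonneg: "\<And>u. 0 \<le> u \<Longrightarrow> 0 \<le> right_deriv \<phi> u" and C: "convex C"
    and min: "is_arg_min (\<lambda>z. gf y \<bullet> (z - y) + L / 2 * (norm (z - y))\<^sup>2 + (\<Sum>i\<in>UNIV. s $ i * \<bar>z $ i\<bar>))
       (\<lambda>z. z \<in> C) p"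
  obtains \<eta> where "norm \<eta> \<le> 2 * L * norm (p - y) + CARD('n) * M * norm (p - w)"
    "\<And>z. z \<in> C \<Longrightarrow> unconstrained_objective f \<phi> p + \<eta> \<bullet> (z - p) - M * (norm (z - p))\<^sup>2
       \<le> unconstrained_objective f \<phi> z"
proof -
  define t where "t = separable_right_deriv \<phi> (vec_abs p)"
  have ti: "t $ i = right_deriv \<phi> \<bar>p $ i\<bar>" and si: "s $ i = right_deriv \<phi> \<bar>w $ i\<bar>" for i
    by (simp_all add: t_def s_def separable_right_deriv_def vec_abs_def)
  have M: "0 \<le> M" using phi_lip by (rule lipschitz_on_nonneg)
  have lipM: "\<bar>right_deriv \<phi> u - right_deriv \<phi> v\<bar> \<le> M * \<bar>u - v\<bar>" if "0 \<le> u" "0 \<le> v" for u v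
    using lipschitz_onD[OF phi_lip, of u v] that by (simp add: dist_real_def)
  have p: "p \<in> C" using min by (simp add: is_arg_min_def)
  define g where "g z = gf p \<bullet> (z - p) + (\<Sum>i\<in>UNIV. t $ i * \<bar>z $ i\<bar>)" for z
  let ?e = "2 * L * norm (p - y) + CARD('n) * M * norm (p - w)"
  have conv: "convex_on C g"
    unfolding g_def by (intro convex_on_weighted_l1 C) (simp add: ti nonneg)
  have e: "0 \<le> ?e" using L M by simp
  have minor: "g p - ?e * norm (z - p) \<le> g z" if z: "z \<in> C" for z
  proof -
    let ?a = "gf y + L *\<^sub>R (p - y)"
    \<comment> \<open>The gradient at \<open>y\<close> and the quadratic term of the subproblem each cost \<open>L * \<parallel>p - y\<parallel>\<close>.\<close>
    have "norm (gf p - ?a) \<le> norm (gf p - gf y) + norm (L *\<^sub>R (p - y))"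
      using norm_triangle_ineq4[of "gf p - gf y" "L *\<^sub>R (p - y)"] by (simp add: algebra_simps)
    also have "\<dots> \<le> 2 * L * norm (p - y)"
      using lipschitz_onD[OF lip, of p y] L by (simp add: dist_norm)
    finally have "norm (gf p - ?a) * norm (z - p) \<le> 2 * L * norm (p - y) * norm (z - p)"
      by (rule mult_right_mono) simp
    then have 1: "- (2 * L * norm (p - y) * norm (z - p)) \<le> (gf p - ?a) \<bullet> (z - p)"
      using Cauchy_Schwarz_ineq2[of "gf p - ?a" "z - p"] by linarith
    have "- (M * norm (p - w) * norm (z - p)) \<le> (t $ i - s $ i) * (\<bar>z $ i\<bar> - \<bar>p $ i\<bar>)" for i
    proof -
      have "\<bar>t $ i - s $ i\<bar> \<le> M * \<bar>\<bar>p $ i\<bar> - \<bar>w $ i\<bar>\<bar>"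
        unfolding ti si by (rule lipM) auto
      also have "\<dots> \<le> M * norm (p - w)"
        using component_le_norm_cart[of "p - w" i] M by (intro mult_left_mono) auto
      finally have "\<bar>t $ i - s $ i\<bar> * \<bar>\<bar>z $ i\<bar> - \<bar>p $ i\<bar>\<bar> \<le> M * norm (p - w) * norm (z - p)"
        using component_le_norm_cart[of "z - p" i] M by (intro mult_mono) auto
      then show ?thesis
        unfolding abs_mult[symmetric] by linarith
    qed
    then have "(\<Sum>i\<in>(UNIV :: 'n set). - (M * norm (p - w) * norm (z - p)))
        \<le> (\<Sum>i\<in>UNIV. (t $ i - s $ i) * (\<bar>z $ i\<bar> - \<bar>p $ i\<bar>))"
      by (rule sum_mono)
    then have 2: "- (CARD('n) * M * norm (p - w) * norm (z - p))
        \<le> (\<Sum>i\<in>UNIV. (t $ i - s $ i) * (\<bar>z $ i\<bar> - \<bar>p $ i\<bar>))"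
      by (simp add: mult.assoc)
    have 3: "0 \<le> ?a \<bullet> (z - p) + (\<Sum>i\<in>UNIV. s $ i * (\<bar>z $ i\<bar> - \<bar>p $ i\<bar>))"
      by (rule reweighted_l1_variational_inequality[OF _ C min z]) (simp add: si nonneg)
    have "g z - g p = ((gf p - ?a) \<bullet> (z - p) + ?a \<bullet> (z - p))
       + ((\<Sum>i\<in>UNIV. (t $ i - s $ i) * (\<bar>z $ i\<bar> - \<bar>p $ i\<bar>)) + (\<Sum>i\<in>UNIV. s $ i * (\<bar>z $ i\<bar> - \<bar>p $ i\<bar>)))"
      unfolding inner_add_left[symmetric] sum.distrib[symmetric]
      by (simp add: g_def algebra_simps sum_subtractf)
    then show ?thesis using 1 2 3 by (simp add: algebra_simps)
  qed
  obtain \<eta> where \<eta>: "norm \<eta> \<le> ?e" "\<And>z. z \<in> C \<Longrightarrow> g p + \<eta> \<bullet> (z - p) \<le> g z"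
    using subgradient_of_conic_minorant[OF conv p e minor] by blast
  show thesis
  proof (rule that[OF \<eta>(1)])
    fix z assume z: "z \<in> C"
    have "t $ i * (\<bar>z $ i\<bar> - \<bar>p $ i\<bar>) - M * ((z - p) $ i)\<^sup>2 \<le> \<phi> \<bar>z $ i\<bar> - \<phi> \<bar>p $ i\<bar>" for i
    proof -
      let ?u = "\<bar>p $ i\<bar>" and ?v = "\<bar>z $ i\<bar>"
      have "\<bar>right_deriv \<phi> ?v - right_deriv \<phi> ?u\<bar> * \<bar>?v - ?u\<bar> \<le> M * \<bar>?v - ?u\<bar> * \<bar>?v - ?u\<bar>"
        using lipM[of ?v ?u] by (intro mult_right_mono) auto
      also have "\<dots> \<le> M * (\<bar>(z - p) $ i\<bar> * \<bar>(z - p) $ i\<bar>)"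
        unfolding mult.assoc using M by (intro mult_left_mono mult_mono) auto
      finally have "- (M * ((z - p) $ i)\<^sup>2) \<le> (right_deriv \<phi> ?v - right_deriv \<phi> ?u) * (?v - ?u)"
        unfolding abs_mult[symmetric] power2_eq_square[symmetric] by simp
      moreover have "\<phi> ?u \<le> \<phi> ?v + right_deriv \<phi> ?v * (?u - ?v)"
        by (rule phi) auto
      ultimately show ?thesis by (simp add: ti algebra_simps)
    qed
    then have "(\<Sum>i\<in>UNIV. t $ i * (\<bar>z $ i\<bar> - \<bar>p $ i\<bar>) - M * ((z - p) $ i)\<^sup>2)
        \<le> (\<Sum>i\<in>UNIV. \<phi> \<bar>z $ i\<bar> - \<phi> \<bar>p $ i\<bar>)"
      by (rule sum_mono)
    then have "(\<Sum>i\<in>UNIV. t $ i * (\<bar>z $ i\<bar> - \<bar>p $ i\<bar>)) - M * (\<Sum>i\<in>UNIV. ((z - p) $ i)\<^sup>2)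
        \<le> separable_sum \<phi> (vec_abs z) - separable_sum \<phi> (vec_abs p)"
      by (simp add: sum_subtractf sum_distrib_left separable_sum_def vec_abs_def)
    moreover have "(\<Sum>i\<in>UNIV. ((z - p) $ i)\<^sup>2) = (norm (z - p))\<^sup>2"
      unfolding power2_norm_eq_inner by (simp add: inner_vec_def power2_eq_square)
    moreover have "f p + gf p \<bullet> (z - p) \<le> f z"
      by (rule convex_gradient_inequality[OF convex grad])
    moreover have "g z - g p = gf p \<bullet> (z - p) + (\<Sum>i\<in>UNIV. t $ i * (\<bar>z $ i\<bar> - \<bar>p $ i\<bar>))"
      by (simp add: g_def algebra_simps sum_subtractf)
    ultimately show "unconstrained_objective f \<phi> p + \<eta> \<bullet> (z - p) - M * (norm (z - p))\<^sup>2
       \<le> unconstrained_objective f \<phi> z"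
      using \<eta>(2)[OF z] by (simp add: unconstrained_objective_def)
  qed
qed

lemma objective_regular_subgradient:
  assumes "p \<in> C" "\<And>z. z \<in> C \<Longrightarrow> unconstrained_objective f \<phi> p + \<eta> \<bullet> (z - p) - M * (norm (z - p))\<^sup>2
       \<le> unconstrained_objective f \<phi> z"
  shows "\<eta> \<in> regular_subdiff (objective f C \<phi>) p"
  using assms by (intro proximal_subgradient_regular[where K = M]) (auto simp: objective_eq)

text \<open>The coupling term \<open>L/2 * \<parallel>x - y\<parallel>\<^sup>2\<close> is convex, so it lies above its linearization and its
  gradient \<open>(L (p - w), L (w - p))\<close> can be added to \<open>\<eta>\<close> without further error.\<close>

lemma H1_regular_subgradient:
  assumes p: "p \<in> C" and L: "0 \<le> L" and M: "0 \<le> M"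
    and prox: "\<And>z. z \<in> C \<Longrightarrow> unconstrained_objective f \<phi> p + \<eta> \<bullet> (z - p) - M * (norm (z - p))\<^sup>2
       \<le> unconstrained_objective f \<phi> z"
  shows "(\<eta> + L *\<^sub>R (p - w), L *\<^sub>R (w - p)) \<in> regular_subdiff (H1 L f C \<phi>) (p, w)"
proof (rule proximal_subgradient_regular[where K = M])
  let ?\<zeta> = "(\<eta> + L *\<^sub>R (p - w), L *\<^sub>R (w - p))"
  let ?r = "unconstrained_objective f \<phi> p + L / 2 * (norm (p - w))\<^sup>2"
  show "H1 L f C \<phi> (p, w) = ereal ?r" using p by (simp add: H1_eq)
  fix zv :: "(real ^ 'a) \<times> (real ^ 'a)"
  obtain z v where zv: "zv = (z, v)" by (cases zv)
  show "ereal (?r + ?\<zeta> \<bullet> (zv - (p, w)) - M * (norm (zv - (p, w)))\<^sup>2) \<le> H1 L f C \<phi> zv"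
  proof (cases "z \<in> C")
    case True
    have "(norm (z - v))\<^sup>2 = (norm (p - w))\<^sup>2 + 2 * ((p - w) \<bullet> ((z - v) - (p - w)))
        + (norm ((z - v) - (p - w)))\<^sup>2"
      unfolding power2_norm_eq_inner by (simp add: inner_diff_left inner_diff_right inner_commute)
    then have "(norm (p - w))\<^sup>2 + 2 * ((p - w) \<bullet> ((z - v) - (p - w))) \<le> (norm (z - v))\<^sup>2"
      by simp
    from mult_left_mono[OF this, of "L / 2"] L
    have "L / 2 * (norm (p - w))\<^sup>2 + L * ((p - w) \<bullet> ((z - v) - (p - w))) \<le> L / 2 * (norm (z - v))\<^sup>2"
      by (simp add: algebra_simps)
    moreover have "L * ((p - w) \<bullet> ((z - v) - (p - w)))
        = (L *\<^sub>R (p - w)) \<bullet> (z - p) + (L *\<^sub>R (w - p)) \<bullet> (v - w)"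
      by (simp add: algebra_simps inner_diff_left inner_diff_right)
    moreover have "M * (norm (z - p))\<^sup>2 \<le> M * (norm (zv - (p, w)))\<^sup>2"
      unfolding zv using M by (intro mult_left_mono) (auto simp: norm_Pair)
    ultimately show ?thesis
      using True prox[OF True] by (simp add: zv H1_eq inner_add_left)
  qed (simp add: zv H1_eq)
qed

section \<open>Convergence of the whole sequence\<close>

theorem theorem3p4:
  fixes f :: "real ^ 'n \<Rightarrow> real" and gf :: "real ^ 'n \<Rightarrow> real ^ 'n" and L :: real
    and C :: "(real ^ 'n) set" and \<phi> :: "real \<Rightarrow> real" and l :: real
    and \<beta> :: "nat \<Rightarrow> real" and x :: "nat \<Rightarrow> real ^ 'n"
  assumes f_convex: "convex_on UNIV f"
    and f_grad: "\<And>z. GDERIV f z :> gf z"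
    and gf_cont: "continuous_on UNIV gf"
    and L_pos: "L > 0"
    and gf_lipschitz: "L-lipschitz_on UNIV gf"
    and C: "C \<noteq> {}" "closed C" "convex C"
    and phi_nonneg: "\<And>t. t \<ge> 0 \<Longrightarrow> \<phi> t \<ge> 0"
    and phi_cont: "continuous_on {0..} \<phi>"
    and phi_concave: "concave_on {0..} \<phi>"
    and phi_0: "\<phi> 0 = 0"
    and phi_C1: "\<phi> C1_differentiable_on {0<..}"
    and phi_deriv_lim: "(deriv \<phi> \<longlongrightarrow> l) (at_right 0)"
    and level_bdd: "level_bounded (objective f C \<phi>)"
    and beta: "\<And>k. 0 \<le> \<beta> k \<and> \<beta> k < 1"
    and beta_sup: "(SUP k. \<beta> k) < 1"
    and phi_right_deriv_lipschitz: "\<exists>M. M-lipschitz_on {0..} (right_deriv \<phi>)"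
    and KL: "KL_function (H1 L f C \<phi>)"
    and seq: "IRL1e1_sequence L gf C \<phi> \<beta> x"
  shows "summable (\<lambda>k. norm (x (Suc k) - x k)) \<and>
    (\<exists>p. x \<longlonglongrightarrow> p \<and> 0 \<in> limiting_subdiff (objective f C \<phi>) p)"
proof -
  define F where "F = unconstrained_objective f \<phi>"
  define d where "d k = norm (x (Suc k) - x k)" for k
  have dnn: "0 \<le> d k" for k by (simp add: d_def)
  obtain M where M_lip: "M-lipschitz_on {0..} (right_deriv \<phi>)"
    using phi_right_deriv_lipschitz by blast
  then have M: "0 \<le> M" by (rule lipschitz_on_nonneg)
  have phi: "\<phi> v \<le> \<phi> u + right_deriv \<phi> u * (v - u)" if "0 \<le> u" "0 \<le> v" for u v
    using that by (rule right_deriv_supergradient[OF phi_cont phi_concave phi_C1 phi_deriv_lim])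
  have slope_nonneg: "0 \<le> right_deriv \<phi> u" if "0 \<le> u" for u
    by (rule right_deriv_nonneg[OF phi_nonneg phi[OF that] that])
  let ?s = "\<lambda>k. separable_right_deriv \<phi> (vec_abs (x k))" and ?y = "extrapolated \<beta> x"
  have s: "0 \<le> ?s k $ i" for k i
    by (simp add: separable_right_deriv_def vec_abs_def slope_nonneg)
  have step: "is_arg_min (\<lambda>z. gf (?y k) \<bullet> (z - ?y k) + L / 2 * (norm (z - ?y k))\<^sup>2
      + (\<Sum>i\<in>UNIV. ?s k $ i * \<bar>z $ i\<bar>)) (\<lambda>z. z \<in> C) (x (Suc k))" for k
    using seq by (simp add: IRL1e1_sequence_def Let_def)
  have xC: "x k \<in> C" for k
  proof (cases k)
    case 0
    then show ?thesis using seq by (simp add: IRL1e1_sequence_def)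
  next
    case (Suc m)
    then show ?thesis using step[of m] by (simp add: is_arg_min_def)
  qed
  define b where "b = (SUP k. \<beta> k)"
  have "bdd_above (range \<beta>)" using beta by (intro bdd_aboveI2[of _ _ 1]) (simp add: less_imp_le)
  then have \<beta>b: "\<beta> k \<le> b" for k unfolding b_def by (intro cSUP_upper) auto
  have b: "0 \<le> b" "b < 1" using beta[of 0] \<beta>b[of 0] beta_sup by (auto simp: b_def)
  have y: "norm (x (Suc k) - ?y (Suc k)) \<le> b * d k" for k
    using beta[of "Suc k"] \<beta>b[of "Suc k"] by (auto simp: extrapolated_def d_def intro: mult_right_mono)

  \<comment> \<open>Indices are shifted by one: \<open>E k\<close> is the value of \<open>H1\<close> at \<open>(x (k+1), x k)\<close>, so
    that every extrapolation considered below starts from two genuine consecutive iterates.\<close>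
  define D where "D = L / 2 * (1 - b\<^sup>2)"
  have "b\<^sup>2 < 1" using b by (simp add: abs_square_less_1)
  then have D: "0 < D" using L_pos by (simp add: D_def)
  define E where "E k = F (x (Suc k)) + L / 2 * (d k)\<^sup>2" for k
  have descent: "E (Suc k) \<le> E k - D * (d k)\<^sup>2" for k
  proof -
    have "E (Suc k) \<le> F (x (Suc k)) + L / 2 * (norm (x (Suc k) - ?y (Suc k)))\<^sup>2"
      unfolding E_def F_def d_def
      by (rule IRL_step_descent[OF f_convex f_grad gf_lipschitz phi s C(3) xC step])
    also have "\<dots> \<le> F (x (Suc k)) + L / 2 * (b * d k)\<^sup>2"
      using y L_pos by (intro add_left_mono mult_left_mono power_mono) auto
    finally show ?thesis by (simp add: E_def D_def power_mult_distrib algebra_simps)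
  qed

  \<comment> \<open>The summand \<open>2 * L\<close> accounts for the two components of the gradient of the coupling term.\<close>
  define c where "c = 2 * L + CARD('n) * M + 2 * L"
  have c: "0 \<le> c" using L_pos M by (simp add: c_def)
  have "\<exists>\<eta>. norm \<eta> \<le> (2 * L + CARD('n) * M) * (d (Suc k) + d k)
      \<and> (\<forall>z\<in>C. F (x (Suc (Suc k))) + \<eta> \<bullet> (z - x (Suc (Suc k))) - M * (norm (z - x (Suc (Suc k))))\<^sup>2 \<le> F z)" for k
  proof -
    let ?p = "x (Suc (Suc k))"
    obtain \<eta> where \<eta>: "norm \<eta> \<le> 2 * L * norm (?p - ?y (Suc k)) + CARD('n) * M * norm (?p - x (Suc k))"
      "\<And>z. z \<in> C \<Longrightarrow> F ?p + \<eta> \<bullet> (z - ?p) - M * (norm (z - ?p))\<^sup>2 \<le> F z"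
      using IRL_step_proximal_subgradient[OF f_convex f_grad less_imp_le[OF L_pos] gf_lipschitz phi M_lip
          slope_nonneg C(3) step[of "Suc k"]] unfolding F_def by blast
    have "norm (?p - ?y (Suc k)) \<le> d (Suc k) + norm (x (Suc k) - ?y (Suc k))"
      using norm_triangle_ineq[of "?p - x (Suc k)" "x (Suc k) - ?y (Suc k)"] by (simp add: d_def)
    also have "\<dots> \<le> d (Suc k) + d k"
      using y[of k] mult_right_mono[OF less_imp_le[OF b(2)] dnn[of k]] by simp
    finally have "2 * L * norm (?p - ?y (Suc k)) \<le> 2 * L * (d (Suc k) + d k)"
      using L_pos by (intro mult_left_mono) auto
    moreover have "CARD('n) * M * norm (?p - x (Suc k)) \<le> CARD('n) * M * (d (Suc k) + d k)"
      using M dnn by (intro mult_left_mono) (auto simp: d_def)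
    ultimately show ?thesis
      using \<eta> by (intro exI[of _ \<eta>]) (auto simp: algebra_simps)
  qed
  then obtain \<eta> where \<eta>: "\<And>k. norm (\<eta> k) \<le> (2 * L + CARD('n) * M) * (d (Suc k) + d k)"
    and prox: "\<And>k z. z \<in> C \<Longrightarrow> F (x (Suc (Suc k))) + \<eta> k \<bullet> (z - x (Suc (Suc k)))
       - M * (norm (z - x (Suc (Suc k))))\<^sup>2 \<le> F z"
    by metis
  have \<eta>_sub: "\<eta> k \<in> regular_subdiff (objective f C \<phi>) (x (Suc (Suc k)))" for k
    by (rule objective_regular_subgradient[OF xC prox[unfolded F_def]])
  define Z where "Z k = (x (Suc (Suc k)), x (Suc k))" for k
  define \<zeta> where "\<zeta> k = (\<eta> k + L *\<^sub>R (x (Suc (Suc k)) - x (Suc k)), L *\<^sub>R (x (Suc k) - x (Suc (Suc k))))" for k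
  have \<zeta>_sub: "\<zeta> k \<in> regular_subdiff (H1 L f C \<phi>) (Z k)" for k
    unfolding \<zeta>_def Z_def
    by (rule H1_regular_subgradient[OF xC less_imp_le[OF L_pos] M prox[unfolded F_def]])
  have \<zeta>_norm: "norm (\<zeta> k) \<le> c * (d (Suc k) + d k)" for k
  proof -
    have "norm (\<zeta> k) \<le> norm (\<eta> k + L *\<^sub>R (x (Suc (Suc k)) - x (Suc k)))
        + norm (L *\<^sub>R (x (Suc k) - x (Suc (Suc k))))"
      unfolding \<zeta>_def by (rule norm_Pair_le)
    also have "\<dots> \<le> norm (\<eta> k) + L * d (Suc k) + L * d (Suc k)"
      using norm_triangle_ineq[of "\<eta> k" "L *\<^sub>R (x (Suc (Suc k)) - x (Suc k))"] L_pos
      by (simp add: d_def norm_minus_commute)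
    also have "\<dots> \<le> (2 * L + CARD('n) * M) * (d (Suc k) + d k) + 2 * L * (d (Suc k) + d k)"
      using \<eta>[of k] mult_nonneg_nonneg[OF less_imp_le[OF L_pos] dnn[of k]] by (simp add: algebra_simps)
    finally show ?thesis by (simp add: c_def algebra_simps)
  qed

  have "decseq E"
  proof (rule decseq_SucI)
    fix k
    have "0 \<le> D * (d k)\<^sup>2" using D by simp
    then show "E (Suc k) \<le> E k" using descent[of k] by linarith
  qed
  have "range (x \<circ> Suc) \<subseteq> {z. objective f C \<phi> z \<le> ereal (E 0)}"
  proof -
    have "F (x (Suc k)) \<le> E 0" for k
    proof -
      have "0 \<le> L / 2 * (d k)\<^sup>2" using L_pos by simp
      then show ?thesis using decseqD[OF \<open>decseq E\<close>, of 0 k] by (simp add: E_def)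
    qed
    then show ?thesis by (auto simp: objective_eq xC F_def)
  qed
  then have bdd: "bounded (range (x \<circ> Suc))"
    using level_bdd by (auto simp: level_bounded_def intro: bounded_subset)
  then obtain R where R: "\<And>k. norm (x (Suc k)) \<le> R" by (auto simp: bounded_iff)
  \<comment> \<open>The tangent plane of \<open>f\<close> at 0 is a minorant of \<open>f\<close> and is bounded on bounded sets.\<close>
  have "f 0 - norm (gf 0) * R \<le> E k" for k
  proof -
    have "norm (gf 0) * norm (x (Suc k)) \<le> norm (gf 0) * R"
      using R by (intro mult_left_mono) auto
    then have "f 0 - norm (gf 0) * R \<le> f 0 + gf 0 \<bullet> (x (Suc k) - 0)"
      using Cauchy_Schwarz_ineq2[of "gf 0" "x (Suc k)"] by auto
    also have "\<dots> \<le> f (x (Suc k))" by (rule convex_gradient_inequality[OF f_convex f_grad])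
    also have "\<dots> \<le> F (x (Suc k))"
      unfolding F_def unconstrained_objective_def separable_sum_def vec_abs_def
      by (simp add: sum_nonneg phi_nonneg)
    finally show ?thesis using L_pos by (simp add: E_def add_increasing2)
  qed
  then obtain E' where E': "E \<longlonglongrightarrow> E'" "\<And>k. E' \<le> E k"
    using decseq_convergent[OF \<open>decseq E\<close>] by metis
  have d0: "d \<longlonglongrightarrow> 0" by (rule descent_imp_steps_vanish[OF D descent E'(1)])
  have dd0: "(\<lambda>k. C' * (d (Suc k) + d k)) \<longlonglongrightarrow> 0" for C'
    using tendsto_mult_left[OF tendsto_add[OF LIMSEQ_Suc[OF d0] d0], of C'] by simp
  have \<zeta>0: "\<zeta> \<longlonglongrightarrow> 0"
    by (rule Lim_null_comparison[OF _ dd0[of c]]) (simp add: \<zeta>_norm)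
  have \<eta>0: "\<eta> \<longlonglongrightarrow> 0"
    by (rule Lim_null_comparison[OF _ dd0[of "2 * L + CARD('n) * M"]]) (simp add: \<eta>)

  obtain p \<sigma> where \<sigma>: "strict_mono \<sigma>" and "((x \<circ> Suc) \<circ> \<sigma>) \<longlonglongrightarrow> p"
    using bounded_imp_convergent_subsequence[OF bdd] by blast
  then have lim1: "(\<lambda>j. x (Suc (\<sigma> j))) \<longlonglongrightarrow> p" by (simp add: o_def)
  \<comment> \<open>Since the steps vanish, consecutive iterates have the same limits along any subsequence.\<close>
  have shift: "(\<lambda>j. x (Suc (\<tau> j))) \<longlonglongrightarrow> q \<longleftrightarrow> (\<lambda>j. x (\<tau> j)) \<longlonglongrightarrow> q"
    if "filterlim \<tau> sequentially sequentially" for \<tau> :: "nat \<Rightarrow> nat" and q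
  proof -
    have "(\<lambda>j. d (\<tau> j)) \<longlonglongrightarrow> 0" by (rule filterlim_compose[OF d0 that])
    then have "(\<lambda>j. x (Suc (\<tau> j)) - x (\<tau> j)) \<longlonglongrightarrow> 0"
      by (simp add: d_def tendsto_norm_zero_iff)
    then show ?thesis by (rule Lim_transform_eq)
  qed
  note \<sigma>_lim = filterlim_subseq[OF \<sigma>]
  have lim0: "(x \<circ> \<sigma>) \<longlonglongrightarrow> p"
    using lim1 shift[OF \<sigma>_lim] by (simp add: o_def)
  have lim2: "(\<lambda>j. x (Suc (Suc (\<sigma> j)))) \<longlonglongrightarrow> p"
    using lim1 shift[OF filterlim_compose[OF filterlim_Suc \<sigma>_lim]] by simp
  have pC: "p \<in> C"
    using closed_sequentially[OF C(2) _ lim1] xC by blast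
  have contF: "isCont F z" for z
  proof -
    have "continuous_on UNIV f"
      using f_grad by (auto simp: gderiv_def intro!: continuous_at_imp_continuous_on has_derivative_continuous)
    from continuous_on_unconstrained_objective[OF this phi_cont] show ?thesis
      by (simp add: F_def continuous_on_eq_continuous_at)
  qed
  have "(\<lambda>j. E (\<sigma> j)) \<longlonglongrightarrow> F p + L / 2 * 0\<^sup>2"
    unfolding E_def
    by (intro tendsto_intros isCont_tendsto_compose[OF contF lim1] filterlim_compose[OF d0 \<sigma>_lim])
  moreover have "(\<lambda>j. E (\<sigma> j)) \<longlonglongrightarrow> E'" by (rule filterlim_compose[OF E'(1) \<sigma>_lim])
  ultimately have E'_eq: "E' = F p" using LIMSEQ_unique by fastforce
  have H1_Z: "H1 L f C \<phi> (Z k) = ereal (E (Suc k))" for k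
    by (simp add: Z_def H1_eq xC E_def F_def d_def)
  have H1_p: "H1 L f C \<phi> (p, p) = ereal E'"
    by (simp add: H1_eq pC E'_eq F_def)
  have "0 \<in> limiting_subdiff (H1 L f C \<phi>) (p, p)"
    unfolding limiting_subdiff_def mem_Collect_eq
  proof (intro conjI exI allI)
    show "\<bar>H1 L f C \<phi> (p, p)\<bar> \<noteq> \<infinity>" by (simp add: H1_p)
    show "(\<lambda>j. Z (\<sigma> j)) \<longlonglongrightarrow> (p, p)"
      unfolding Z_def by (intro tendsto_Pair lim1 lim2)
    show "(\<lambda>j. H1 L f C \<phi> (Z (\<sigma> j))) \<longlonglongrightarrow> H1 L f C \<phi> (p, p)"
      unfolding H1_Z H1_p using filterlim_compose[OF LIMSEQ_Suc[OF E'(1)] \<sigma>_lim] by simp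
    show "\<zeta> (\<sigma> j) \<in> regular_subdiff (H1 L f C \<phi>) (Z (\<sigma> j))" for j by (rule \<zeta>_sub)
    show "(\<lambda>j. \<zeta> (\<sigma> j)) \<longlonglongrightarrow> 0" by (rule filterlim_compose[OF \<zeta>0 \<sigma>_lim])
  qed
  then have "KL_property_at (H1 L f C \<phi>) (p, p)"
    using KL by (auto simp: KL_function_def dom_subdiff_def)
  then obtain a V \<psi> where a: "0 < a" and V: "open V" "(p, p) \<in> V" and \<psi>: "\<psi> \<in> desingularizers a"
    and KLV: "\<forall>z\<in>V. H1 L f C \<phi> (p, p) < H1 L f C \<phi> z \<and>
        H1 L f C \<phi> z < H1 L f C \<phi> (p, p) + a \<longrightarrow>
        1 \<le> ereal (deriv \<psi> (real_of_ereal (H1 L f C \<phi> z - H1 L f C \<phi> (p, p))))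
              * edist_set 0 (limiting_subdiff (H1 L f C \<phi>) z)"
    unfolding KL_property_at_def by (elim exE conjE bexE) (rule that)
  obtain A B where AB: "open A" "open B" "(p, p) \<in> A \<times> B" "A \<times> B \<subseteq> V"
    by (rule open_prod_elim[OF V])
  then have "open (A \<inter> B)" "p \<in> A \<inter> B" by auto
  then obtain \<rho> where \<rho>: "0 < \<rho>" and ball: "ball p \<rho> \<subseteq> A \<inter> B"
    using open_contains_ball[of "A \<inter> B"] by blast
  have "summable (\<lambda>k. norm (x (Suc k) - x k))"
  proof (rule KL_finite_length[where r = "\<lambda>k. E k - E'"])
    show "0 < D" "0 \<le> c" "0 < a" "0 < \<rho>" "strict_mono \<sigma>" "(x \<circ> \<sigma>) \<longlonglongrightarrow> p" "\<psi> \<in> desingularizers a"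
      by fact+
    show "E (Suc k) - E' \<le> E k - E' - D * (norm (x (Suc k) - x k))\<^sup>2" for k
      using descent[of k] by (simp add: d_def)
    show "0 \<le> E k - E'" for k using E'(2) by simp
    show "(\<lambda>k. E k - E') \<longlonglongrightarrow> 0" using E'(1) by (simp add: LIM_zero_iff)
    fix k assume near: "dist (x (Suc k)) p < \<rho>" "dist (x (Suc (Suc k))) p < \<rho>"
      and pos: "0 < E (Suc k) - E'" and lt: "ereal (E (Suc k) - E') < a"
    have "Z k \<in> V"
      using near ball AB(4) by (auto simp: Z_def dist_commute subset_iff)
    moreover have "H1 L f C \<phi> (Z k) < H1 L f C \<phi> (p, p) + a"
      using lt unfolding H1_Z H1_p by (cases a) auto
    ultimately have "1 \<le> ereal (deriv \<psi> (E (Suc k) - E'))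
        * edist_set 0 (limiting_subdiff (H1 L f C \<phi>) (Z k))"
      using KLV[rule_format, of "Z k"] pos by (simp add: H1_Z H1_p)
    also have "\<dots> \<le> ereal (deriv \<psi> (E (Suc k) - E')) * ereal (c * (d (Suc k) + d k))"
    proof (rule ereal_mult_left_mono)
      have "edist_set 0 (limiting_subdiff (H1 L f C \<phi>) (Z k)) \<le> ereal (dist 0 (\<zeta> k))"
        unfolding edist_set_def
        by (rule INF_lower) (rule regular_imp_limiting_subdiff[OF \<zeta>_sub])
      then show "edist_set 0 (limiting_subdiff (H1 L f C \<phi>) (Z k)) \<le> ereal (c * (d (Suc k) + d k))"
        using \<zeta>_norm[of k] by (simp add: order_trans)
      show "0 \<le> ereal (deriv \<psi> (E (Suc k) - E'))"
        using \<psi> pos lt by (auto simp: desingularizers_def less_imp_le)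
    qed
    finally show "1 \<le> deriv \<psi> (E (Suc k) - E') *
        (c * (norm (x (Suc (Suc k)) - x (Suc k)) + norm (x (Suc k) - x k)))"
      by (simp add: d_def one_ereal_def)
  qed
  moreover have "x \<longlonglongrightarrow> p"
  proof -
    have "summable (\<lambda>k. x (Suc k) - x k)"
      by (rule summable_norm_cancel) fact
    from summable_LIMSEQ[OF this]
    have "(\<lambda>m. x m - x 0 + x 0) \<longlonglongrightarrow> (\<Sum>k. x (Suc k) - x k) + x 0"
      by (intro tendsto_add tendsto_const) (simp add: sum_lessThan_telescope)
    then obtain q where q: "x \<longlonglongrightarrow> q" by auto
    then have "(x \<circ> \<sigma>) \<longlonglongrightarrow> q" by (rule LIMSEQ_subseq_LIMSEQ) (rule \<sigma>)
    with lim0 q show ?thesis using LIMSEQ_unique by blast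
  qed
  moreover have "0 \<in> limiting_subdiff (objective f C \<phi>) p"
    unfolding limiting_subdiff_def mem_Collect_eq
  proof (intro conjI exI allI)
    show "\<bar>objective f C \<phi> p\<bar> \<noteq> \<infinity>" by (simp add: objective_eq pC)
    show "(\<lambda>j. x (Suc (Suc j))) \<longlonglongrightarrow> p" using \<open>x \<longlonglongrightarrow> p\<close> by (intro LIMSEQ_Suc)
    then show "(\<lambda>j. objective f C \<phi> (x (Suc (Suc j)))) \<longlonglongrightarrow> objective f C \<phi> p"
      using isCont_tendsto_compose[OF contF] by (simp add: objective_eq xC pC flip: F_def)
    show "\<eta> j \<in> regular_subdiff (objective f C \<phi>) (x (Suc (Suc j)))" for j by (rule \<eta>_sub)
    show "\<eta> \<longlonglongrightarrow> 0" by (rule \<eta>0)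
  qed
  ultimately show ?thesis by blast
qed

end
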